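(* Let $V\subset\mathbb{R}^2$ be a bounded measurable set. Then $\chi_V$ is not an eigenvector of the double Hilbert transform $\mathbf{H}:L^2(\mathbb{R}^2)\to L^2(\mathbb{R}^2)$.
   Context: $\chi_V$ is the indicator function of $V$. $\mathbf{H}=\mathcal{H}_2\mathcal{H}_1=\mathcal{H}_1\mathcal{H}_2$ on $L^2(\mathbb{R}^2)$, where $\mathcal{H}_1,\mathcal{H}_2$ are the Hilbert transforms $\mathcal{H}f(x)=\frac1\pi\,\mathrm{p.v.}\int_{\mathbb{R}}\frac{f(t)}{x-t}\,dt$ acting in the first and the second variable respectively. Equivalently, $\widehat{\mathbf{H}f}=\phi\hat f$ with $\phi=-1$ on the open first and third quadrants and $\phi=1$ on the open second and fourth quadrants. An eigenvector is by definition a nonzero element of $L^2(\mathbb{R}^2)$. *)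

theory Defs
  imports "HOL-Analysis.Analysis"
begin

text \<open>
  Elements of \<open>L\<^sup>2(\<real>\<^sup>2)\<close> are represented by complex-valued functions on
  \<^typ>\<open>real \<times> real\<close>, two representatives being identified when they agree almost everywhere.
\<close>

definition square_integrable :: "(real \<times> real \<Rightarrow> complex) \<Rightarrow> bool" where
  "square_integrable f \<longleftrightarrow>
     f \<in> borel_measurable lebesgue \<and> integrable lebesgue (\<lambda>p. (cmod (f p))\<^sup>2)"

text \<open>
  The principal value of a square-integrable function exists almost everywhere; on the
  exceptional null set \<^const>\<open>Lim\<close> takes an irrelevant value. The integral is taken with respect
  to the complete measure \<^const>\<open>lebesgue\<close> rather than \<^const>\<open>lborel\<close>, because it must be applied
  to sections, and to functions altered on a null set, that need not be Borel measurable.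
\<close>

definition hilbert_transform :: "(real \<Rightarrow> complex) \<Rightarrow> real \<Rightarrow> complex" where
  "hilbert_transform f x =
     complex_of_real (1 / pi) *
     Lim (at_right 0)
       (\<lambda>\<epsilon>. LINT t:{t. \<epsilon> < \<bar>x - t\<bar>}|lebesgue. f t / complex_of_real (x - t))"

definition hilbert_transform_fst ::
    "(real \<times> real \<Rightarrow> complex) \<Rightarrow> real \<times> real \<Rightarrow> complex" where
  "hilbert_transform_fst f = (\<lambda>(x, y). hilbert_transform (\<lambda>s. f (s, y)) x)"

definition hilbert_transform_snd ::
    "(real \<times> real \<Rightarrow> complex) \<Rightarrow> real \<times> real \<Rightarrow> complex" where
  "hilbert_transform_snd f = (\<lambda>(x, y). hilbert_transform (\<lambda>t. f (x, t)) y)"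

definition double_hilbert_transform ::
    "(real \<times> real \<Rightarrow> complex) \<Rightarrow> real \<times> real \<Rightarrow> complex" where
  "double_hilbert_transform f = hilbert_transform_snd (hilbert_transform_fst f)"

text \<open>
  Eigenvectors in \<open>L\<^sup>2(\<real>\<^sup>2)\<close> of an operator \<open>T\<close> given on representatives.
\<close>

definition L2_eigenvector ::
    "((real \<times> real \<Rightarrow> complex) \<Rightarrow> real \<times> real \<Rightarrow> complex) \<Rightarrow>
     (real \<times> real \<Rightarrow> complex) \<Rightarrow> bool" where
  "L2_eigenvector T f \<longleftrightarrow>
     square_integrable f \<and> \<not> (AE p in lebesgue. f p = 0) \<and>
     (\<exists>c::complex. AE p in lebesgue. T f p = c * f p)"

end

theory Submission
  imports Defs
begin

text \<open>
  Let \<open>V\<close> lie in the square \<open>[-R, R]\<^sup>2\<close>. If \<open>x > R\<close> and \<open>y > R\<close>, then no principal value is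
  needed and the double Hilbert transform of the indicator function of \<open>V\<close> at \<open>(x, y)\<close> is
  \<open>1/\<pi>\<^sup>2\<close> times the integral of \<open>1 / ((x - s) (y - t))\<close> over \<open>(s, t) \<in> V\<close>. The integrand is
  positive, so the transform does not vanish anywhere on the quadrant \<open>x, y > R\<close> unless \<open>V\<close> is
  null, whereas every multiple of the indicator function vanishes there.
\<close>

text \<open>For \<open>e < x - R\<close> the truncation only discards points where \<open>f\<close>
  vanishes, so the truncated integrals are constant near \<open>0\<close> and \<open>Lim\<close>
  picks that constant.\<close>

lemma hilbert_transform_right_of_support:
  assumes supp: "\<And>t. f t \<noteq> 0 \<Longrightarrow> t \<le> R" and x: "R < x"
  shows "hilbert_transform f x =
    complex_of_real (1 / pi) * (LINT t|lebesgue. f t / complex_of_real (x - t))"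
proof -
  have "(LINT t:{t. e < \<bar>x - t\<bar>}|lebesgue. f t / complex_of_real (x - t)) =
      (LINT t|lebesgue. f t / complex_of_real (x - t))" if "e < x - R" for e
    unfolding set_lebesgue_integral_def
  proof (intro Bochner_Integration.integral_cong refl)
    fix t
    show "indicator {t. e < \<bar>x - t\<bar>} t *\<^sub>R (f t / complex_of_real (x - t)) =
        f t / complex_of_real (x - t)"
      using that supp[of t] by (cases "f t = 0") auto
  qed
  then have "eventually (\<lambda>e. (LINT t:{t. e < \<bar>x - t\<bar>}|lebesgue. f t / complex_of_real (x - t)) =
      (LINT t|lebesgue. f t / complex_of_real (x - t))) (at_right 0)"
    using x by (auto simp: eventually_at_right[of 0 "x - R"] intro!: exI[of _ "x - R"])
  then show ?thesis
    unfolding hilbert_transform_def by (simp add: tendsto_Lim tendsto_eventually)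
qed

text \<open>Sections of \<open>V\<close> and the inner transform may fail to be Borel. This passes
  to a Borel representative, for which Fubini on \<open>lborel\<close> is available; completeness of
  \<open>lebesgue\<close> makes \<open>f\<close> measurable.\<close>

lemma integral_lebesgue_eq_lborel_AE:
  fixes f g :: "'a::euclidean_space \<Rightarrow> 'b::euclidean_space"
  assumes g: "g \<in> borel_measurable borel" and eq: "AE x in lborel. f x = g x"
  shows "integral\<^sup>L lebesgue f = integral\<^sup>L lborel g"
proof -
  have g': "g \<in> borel_measurable lebesgue"
    using g by (intro measurable_completion) simp
  have eq': "AE x in lebesgue. f x = g x"
    using eq by (rule AE_completion)
  then have "f \<in> borel_measurable lebesgue"
    by (intro borel_measurable_AE[OF g']) auto
  then have "integral\<^sup>L lebesgue f = integral\<^sup>L lebesgue g"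
    using g' eq' by (rule integral_cong_AE)
  also have "\<dots> = integral\<^sup>L lborel g"
    using g by (intro integral_completion) simp
  finally show ?thesis .
qed

lemma double_hilbert_transform_indicator_nonzero:
  fixes V :: "(real \<times> real) set"
  assumes V: "V \<in> sets lebesgue" and nonnull: "\<not> (AE p in lborel. p \<notin> V)"
    and bd: "\<And>s t. (s, t) \<in> V \<Longrightarrow> \<bar>s\<bar> \<le> R \<and> \<bar>t\<bar> \<le> R"
    and x: "R < x" and y: "R < y"
  shows "double_hilbert_transform (indicator V) (x, y) \<noteq> 0"
proof -
  \<comment> \<open>\<open>B\<close> is a Borel set that differs from \<open>V\<close> only inside
    the null set \<open>N'\<close>, so the kernel \<open>k\<close> built on it is jointly
    Borel.\<close>
  obtain B N N' where VBN: "V = B \<union> N" "N \<subseteq> N'" "N' \<in> null_sets lborel" and "B \<in> sets lborel"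
    using V by (rule sets_completionE)
  then have B [measurable]: "B \<in> sets borel"
    by simp
  define k where "k = (\<lambda>s t. indicator B (s, t) / ((x - s) * (y - t)) :: real)"
  have k_meas [measurable]: "case_prod k \<in> borel_measurable (borel \<Otimes>\<^sub>M borel)"
  proof -
    have [measurable]: "B \<in> sets (borel \<Otimes>\<^sub>M borel)"
      using B unfolding borel_prod .
    show ?thesis
      unfolding k_def by measurable
  qed
  have BR: "\<bar>s\<bar> \<le> R" "\<bar>t\<bar> \<le> R" if "(s, t) \<in> B" for s t
    using bd[of s t] that VBN by auto
  have AE_N': "AE p in lborel. p \<notin> N'"
    using VBN(3) by (rule AE_not_in)
  \<comment> \<open>The inner transform integrates over \<open>s\<close> with \<open>t\<close>
    fixed, whereas \<open>AE_pair\<close> fixes \<open>s\<close> first. Swapping the two quantifiers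
    requires the complement of \<open>N'\<close> to be measurable.\<close>
  have sections: "AE t in lborel. AE s in lborel. (s, t) \<notin> N'"
  proof -
    have "AE p in lborel \<Otimes>\<^sub>M lborel. p \<notin> N'"
      using AE_N' unfolding lborel_prod .
    then have "AE s in lborel. AE t in lborel. (s, t) \<notin> N'"
      by (rule lborel_pair.AE_pair)
    moreover have "{p \<in> space (lborel \<Otimes>\<^sub>M lborel). (fst p, snd p) \<notin> N'}
        \<in> sets (lborel \<Otimes>\<^sub>M lborel)"
    proof -
      have "N' \<in> sets borel"
        using VBN(3) by auto
      moreover have "{p. p \<notin> N'} = - N'"
        by auto
      ultimately show ?thesis
        unfolding lborel_prod by simp
    qed
    ultimately show ?thesis
      using lborel_pair.AE_commute[of "\<lambda>s t. (s, t) \<notin> N'"] by simp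
  qed
  \<comment> \<open>On \<open>B\<close> both factors of the denominator are at least
    \<open>x - R\<close> and \<open>y - R\<close>, and \<open>B\<close> is bounded, hence of finite
    measure.\<close>
  have k_int: "integrable lborel (case_prod k)"
  proof (rule Bochner_Integration.integrable_bound)
    have "bounded B"
      by (rule bounded_subset[of "{-R..R} \<times> {-R..R}"])
        (use BR in \<open>force intro!: bounded_Times\<close>)+
    then have "emeasure lborel B < \<infinity>"
      by (rule emeasure_bounded_finite)
    then show "integrable lborel (\<lambda>p. indicator B p * (1 / ((x - R) * (y - R))) :: real)"
      by (intro integrable_mult_left integrable_real_indicator) auto
    show "case_prod k \<in> borel_measurable lborel"
      using k_meas unfolding borel_prod by simp
    have "\<bar>k s t\<bar> \<le> indicator B (s, t) * (1 / ((x - R) * (y - R)))" for s t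
    proof (cases "(s, t) \<in> B")
      case True
      have "(x - R) * (y - R) \<le> (x - s) * (y - t)"
        using BR[OF True] x y by (intro mult_mono) auto
      moreover have "0 < (x - R) * (y - R)"
        using x y by simp
      ultimately show ?thesis
        using True by (simp add: k_def frac_le)
    qed (simp add: k_def)
    then show "AE p in lborel. norm (case_prod k p) \<le>
        norm (indicator B p * (1 / ((x - R) * (y - R))) :: real)"
      using x y by (auto intro!: AE_I2 simp: abs_mult)
  qed
  \<comment> \<open>Since \<open>k\<close> is nonnegative, a zero integral forces
    \<open>k = 0\<close> almost everywhere. But \<open>k > 0\<close> on \<open>B\<close>, so
    \<open>B\<close>, and with it \<open>V\<close>, would be null.\<close>
  have pos: "integral\<^sup>L lborel (case_prod k) \<noteq> 0"
  proof
    have "0 \<le> k s t" for s t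
      using BR[of s t] x y by (auto simp: k_def indicator_def)
    moreover assume "integral\<^sup>L lborel (case_prod k) = 0"
    ultimately have "AE p in lborel. case_prod k p = 0"
      by (subst (asm) integral_nonneg_eq_0_iff_AE[OF k_int]) auto
    with AE_N' have "AE p in lborel. p \<notin> V"
    proof eventually_elim
      case (elim p)
      then show ?case
        using BR[of "fst p" "snd p"] x y VBN(1,2)
        by (cases p) (auto simp: k_def indicator_def)
    qed
    with nonnull show False ..
  qed
  have fst_eq: "hilbert_transform_fst (indicator V) (x, t) =
      complex_of_real (1 / pi) * (LINT s|lebesgue. indicator V (s, t) / complex_of_real (x - s))" for t
    unfolding hilbert_transform_fst_def prod.case
    by (rule hilbert_transform_right_of_support[OF _ x]) (use bd in \<open>force simp: indicator_def\<close>)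
  have "double_hilbert_transform (indicator V) (x, y) = complex_of_real (1 / pi) *
      (LINT t|lebesgue. hilbert_transform_fst (indicator V) (x, t) / complex_of_real (y - t))"
    unfolding double_hilbert_transform_def hilbert_transform_snd_def prod.case
  proof (rule hilbert_transform_right_of_support[OF _ y])
    \<comment> \<open>A nonzero inner integral needs a nonempty section of \<open>V\<close> at
      height \<open>t\<close>, so the inner transform is again supported in
      \<open>t \<le> R\<close>.\<close>
    fix t assume "hilbert_transform_fst (indicator V) (x, t) \<noteq> 0"
    then obtain s where "(s, t) \<in> V"
      by (fastforce simp: fst_eq indicator_def)
    then show "t \<le> R"
      using bd by fastforce
  qed
  also have "(LINT t|lebesgue. hilbert_transform_fst (indicator V) (x, t) / complex_of_real (y - t)) =
      (LINT t|lborel. complex_of_real (1 / pi * (LINT s|lborel. k s t)))"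
  proof (rule integral_lebesgue_eq_lborel_AE)
    show "(\<lambda>t. complex_of_real (1 / pi * (LINT s|lborel. k s t))) \<in> borel_measurable borel"
      by measurable
    \<comment> \<open>The equality holds for those \<open>t\<close> whose section of
      \<open>N'\<close> is null: there \<open>V\<close> and \<open>B\<close> have almost equal
      sections, and \<open>1 / (y - t)\<close> is constant in \<open>s\<close>.\<close>
    show "AE t in lborel. hilbert_transform_fst (indicator V) (x, t) / complex_of_real (y - t) =
        complex_of_real (1 / pi * (LINT s|lborel. k s t))"
      using sections
    proof eventually_elim
      case (elim t)
      have "(LINT s|lebesgue. indicator V (s, t) / complex_of_real (x - s)) =
          (LINT s|lborel. complex_of_real (indicator B (s, t) / (x - s)))"
      proof (rule integral_lebesgue_eq_lborel_AE)
        show "(\<lambda>s. complex_of_real (indicator B (s, t) / (x - s))) \<in> borel_measurable borel"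
          by measurable
        show "AE s in lborel. indicator V (s, t) / complex_of_real (x - s) =
            complex_of_real (indicator B (s, t) / (x - s))"
          using elim by eventually_elim (use VBN(1,2) in \<open>auto simp: indicator_def\<close>)
      qed
      moreover have "(LINT s|lborel. k s t) = (LINT s|lborel. indicator B (s, t) / (x - s)) / (y - t)"
        unfolding k_def by (subst integral_divide_zero[symmetric]) (simp add: divide_divide_eq_left)
      ultimately show ?case
        by (simp only: fst_eq integral_complex_of_real) simp
    qed
  qed
  also have "\<dots> = complex_of_real (1 / pi * (LINT t|lborel. LINT s|lborel. k s t))"
    by simp
  also have "(LINT t|lborel. LINT s|lborel. k s t) = integral\<^sup>L lborel (case_prod k)"
    using lborel_pair.integral_snd[of k] k_int unfolding lborel_prod by simp
  finally show ?thesis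
    using pos by simp
qed

theorem lemma1:
  fixes V :: "(real \<times> real) set"
  assumes "bounded V" and "V \<in> sets lebesgue"
  shows "\<not> L2_eigenvector double_hilbert_transform (indicator V)"
proof
  assume "L2_eigenvector double_hilbert_transform (indicator V)"
  then obtain c where nz: "\<not> (AE p in lebesgue. indicator V p = (0::complex))"
    and eig: "AE p in lebesgue. double_hilbert_transform (indicator V) p = c * indicator V p"
    unfolding L2_eigenvector_def by auto
  obtain R where R: "norm p \<le> R" if "p \<in> V" for p
    using \<open>bounded V\<close> by (auto simp: bounded_iff)
  have bd: "\<bar>s\<bar> \<le> R \<and> \<bar>t\<bar> \<le> R" if "(s, t) \<in> V" for s t
    using R[OF that] norm_fst_le[of s t] norm_snd_le[of t s] by auto
  have "\<not> (AE p in lborel. p \<notin> V)"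
    using nz by (simp add: AE_completion_iff indicator_eq_0_iff)
  note nonzero = double_hilbert_transform_indicator_nonzero[OF \<open>V \<in> sets lebesgue\<close> this bd]
  \<comment> \<open>The quadrant misses \<open>V\<close>, so there the eigenvalue equation reads
    \<open>0\<close> on the right for every \<open>c\<close>, while the left side is
    nonzero.\<close>
  have "AE p in lebesgue. p \<notin> {R<..} \<times> {R<..}"
    using eig
  proof eventually_elim
    case (elim p)
    then show ?case
      using nonzero[of "fst p" "snd p"] bd[of "fst p" "snd p"]
      by (cases p) (auto simp: indicator_def split: if_splits)
  qed
  moreover have "open ({R<..} \<times> {R<..})"
    by (simp add: open_Times)
  moreover from this have "{R<..} \<times> {R<..} \<in> sets lebesgue"
    by (intro sets_completionI_sets) simp
  ultimately have "negligible ({R<..} \<times> {R<..})"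
    by (simp add: negligible_iff_null_sets AE_iff_null_sets)
  moreover have "(R + 1, R + 1) \<in> {R<..} \<times> {R<..}"
    by simp
  ultimately show False
    using open_not_negligible[OF \<open>open ({R<..} \<times> {R<..})\<close>] by blast
qed

end
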